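(* If $G\rightrightarrows G_0$ and $H\rightrightarrows H_0$ are two Morita equivalent diffeological groupoids, then there is a diffeomorphism $G_0/G\cong H_0/H$ between their orbit spaces.
   Context: Diffeology. A Euclidean domain is an open subset of some $\mathbb{R}^m$, $m\geq 0$. A diffeology on a set $X$ is a set of functions from Euclidean domains to $X$, called plots, such that: all constant functions are plots; if $\alpha:U\to X$ is a plot and $h:V\to U$ is a smooth map between Euclidean domains, then $\alpha\circ h$ is a plot; a function $\alpha:U\to X$ whose restriction to each member of some open cover of $U$ is a plot is itself a plot. A diffeological space is a set with a diffeology. A function $f$ between diffeological spaces is smooth if $f\circ\alpha$ is a plot for every plot $\alpha$; a diffeomorphism is a smooth bijection with smooth inverse. The plots of a product are the functions whose two components are plots; the plots of a subset are the functions into it that are plots of the ambient space; the fibred product $X\times_Z^{f,g}Y=\{(x,y)\in X\times Y: f(x)=g(y)\}$ has the subset diffeology of the product. The plots of a quotient $X/{\sim}$ (quotient diffeology) are the functions that locally lift along the projection to plots of $X$. A subduction is a smooth surjection $f:X\to Y$ such that for every plot $\alpha:U\to Y$ and $t\in U$ there are an open neighbourhood $V\subseteq U$ of $t$ and a plot $\beta:V\to X$ with $\alpha|_V=f\circ\beta$. Diffeological groupoids. A diffeological groupoid $G\rightrightarrows G_0$ is a groupoid whose object set $G_0$ and arrow set $G$ are diffeological spaces such that source $\mathrm{src}$, target $\mathrm{trg}$, unit $x\mapsto \mathrm{id}_x$, inversion and composition $G\times_{G_0}^{\mathrm{src},\mathrm{trg}}G\to G$, $(g,h)\mapsto g\circ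 h$, are smooth. The orbit of $x\in G_0$ is the set of $y\in G_0$ for which there is an arrow from $x$ to $y$; the orbit space $G_0/G$ is the set of orbits with the quotient diffeology from $G_0$. Actions. A smooth left action of $G$ on a diffeological space $X$ along a smooth map $l_X:X\to G_0$ (left moment map) is a smooth map $G\times_{G_0}^{\mathrm{src},l_X}X\to X$, $(g,x)\mapsto gx$, with $l_X(gx)=\mathrm{trg}(g)$, $\mathrm{id}_{l_X(x)}x=x$ and $h(gx)=(h\circ g)x$ whenever defined. A smooth right action of $H$ on $X$ along $r_X:X\to H_0$ (right moment map) is a smooth map $X\times_{H_0}^{r_X,\mathrm{trg}}H\to X$, $(x,h)\mapsto xh$, with $r_X(xh)=\mathrm{src}(h)$, $x\,\mathrm{id}_{r_X(x)}=x$ and $(xh)h'=x(h\circ h')$ whenever defined. Bibundles and Morita equivalence. A diffeological $(G,H)$-bibundle is a diffeological space $X$ with a smooth left $G$-action along $l_X$ and a smooth right $H$-action along $r_X$ such that $l_X(xh)=l_X(x)$, $r_X(gx)=r_X(x)$ and $(gx)h=g(xh)$ whenever defined. It is biprincipal if $l_X:X\to G_0$ and $r_X:X\to H_0$ are both subductions and both action maps $G\times_{G_0}^{\mathrm{src},l_X}X\to X\times_{H_0}^{r_X,r_X}X$, $(g,x)\mapsto(gx,x)$, and $X\times_{H_0}^{r_X,\mathrm{trg}}H\to X\times_{G_0}^{l_X,l_X}X$, $(x,h)\mapsto(x,xh)$, are diffeomorphisms. $G$ and $H$ are Morita equivalent if there exists a biprincipal $(G,H)$-bibundle. *)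

theory Defs
  imports "HOL-Analysis.Analysis"
begin

section \<open>Smooth maps between Euclidean domains\<close>

text \<open>
  Plots of one diffeology have domains of all dimensions, so \<open>\<real>\<^sup>m\<close> cannot be a type indexed by its
  dimension here.  It is the library's \<^const>\<open>Euclidean_space\<close> \<open>m\<close>: the sequences
  \<open>nat \<Rightarrow> real\<close> vanishing from index \<open>m\<close> on, with the topology of coordinatewise convergence.
\<close>

abbreviation Euclidean_domain :: "nat \<Rightarrow> (nat \<Rightarrow> real) set \<Rightarrow> bool" where
  "Euclidean_domain m U \<equiv> openin (Euclidean_space m) U"

text \<open>
  \<open>C\<^sup>k\<close> functions on an open \<open>U \<subseteq> \<real>\<^sup>m\<close>: continuous, and for \<open>k > 0\<close> all first partial derivatives
  exist on \<open>U\<close> and are \<open>C\<^sup>k\<^sup>-\<^sup>1\<close>.  Only values on \<open>U\<close> matter.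
\<close>

primrec C_k_on :: "nat \<Rightarrow> nat \<Rightarrow> (nat \<Rightarrow> real) set \<Rightarrow> ((nat \<Rightarrow> real) \<Rightarrow> real) \<Rightarrow> bool" where
  "C_k_on 0 m U f \<longleftrightarrow> continuous_on U f"
| "C_k_on (Suc k) m U f \<longleftrightarrow> continuous_on U f \<and>
     (\<forall>i<m. \<exists>f'. C_k_on k m U f' \<and>
        (\<forall>x\<in>U. ((\<lambda>s. f (x(i := s))) has_real_derivative f' x) (at (x i))))"

definition smooth_real_on :: "nat \<Rightarrow> (nat \<Rightarrow> real) set \<Rightarrow> ((nat \<Rightarrow> real) \<Rightarrow> real) \<Rightarrow> bool" where
  "smooth_real_on m U f \<longleftrightarrow> (\<forall>k. C_k_on k m U f)"

definition smooth_domain_map ::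
    "nat \<Rightarrow> (nat \<Rightarrow> real) set \<Rightarrow> nat \<Rightarrow> (nat \<Rightarrow> real) set \<Rightarrow> ((nat \<Rightarrow> real) \<Rightarrow> (nat \<Rightarrow> real)) \<Rightarrow> bool" where
  "smooth_domain_map n V m U h \<longleftrightarrow> h \<in> V \<rightarrow> U \<and> (\<forall>i<m. smooth_real_on n V (\<lambda>x. h x i))"


section \<open>Diffeological spaces\<close>

text \<open>
  \<open>plots X m U\<close> is the set of plots of \<open>X\<close> with domain \<open>U \<subseteq> \<real>\<^sup>m\<close>.  A function with domain \<open>U\<close> is
  represented extensionally, as an element of \<open>U \<rightarrow>\<^sub>E points X\<close>, so that it is determined by its values
  on \<open>U\<close>; restriction and composition are therefore written with \<^const>\<open>restrict\<close>.
\<close>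

record 'a dspace =
  points :: "'a set"
  plots :: "nat \<Rightarrow> (nat \<Rightarrow> real) set \<Rightarrow> ((nat \<Rightarrow> real) \<Rightarrow> 'a) set"

locale diffeological_space =
  fixes X :: "'a dspace"
  assumes plot_domain: "\<alpha> \<in> plots X m U \<Longrightarrow> Euclidean_domain m U"
    and plot_fun: "\<alpha> \<in> plots X m U \<Longrightarrow> \<alpha> \<in> U \<rightarrow>\<^sub>E points X"
    and plot_const: "\<lbrakk>Euclidean_domain m U; x \<in> points X\<rbrakk> \<Longrightarrow> (\<lambda>_\<in>U. x) \<in> plots X m U"
    and plot_compose:
      "\<lbrakk>\<alpha> \<in> plots X m U; Euclidean_domain n V; smooth_domain_map n V m U h\<rbrakk>
        \<Longrightarrow> restrict (\<alpha> \<circ> h) V \<in> plots X n V"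
    and plot_local:
      "\<lbrakk>Euclidean_domain m U; \<alpha> \<in> U \<rightarrow>\<^sub>E points X; \<Union>\<V> = U;
        \<And>V. V \<in> \<V> \<Longrightarrow> Euclidean_domain m V \<and> restrict \<alpha> V \<in> plots X m V\<rbrakk>
        \<Longrightarrow> \<alpha> \<in> plots X m U"

definition smooth_map :: "'a dspace \<Rightarrow> 'b dspace \<Rightarrow> ('a \<Rightarrow> 'b) \<Rightarrow> bool" where
  "smooth_map X Y f \<longleftrightarrow> f \<in> points X \<rightarrow> points Y \<and>
     (\<forall>m U \<alpha>. \<alpha> \<in> plots X m U \<longrightarrow> restrict (f \<circ> \<alpha>) U \<in> plots Y m U)"

definition diffeomorphism :: "'a dspace \<Rightarrow> 'b dspace \<Rightarrow> ('a \<Rightarrow> 'b) \<Rightarrow> bool" where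
  "diffeomorphism X Y f \<longleftrightarrow> bij_betw f (points X) (points Y) \<and>
     smooth_map X Y f \<and> smooth_map Y X (inv_into (points X) f)"

definition subduction :: "'a dspace \<Rightarrow> 'b dspace \<Rightarrow> ('a \<Rightarrow> 'b) \<Rightarrow> bool" where
  "subduction X Y f \<longleftrightarrow> smooth_map X Y f \<and> f ` points X = points Y \<and>
     (\<forall>m U. \<forall>\<alpha>\<in>plots Y m U. \<forall>t\<in>U. \<exists>V. Euclidean_domain m V \<and> t \<in> V \<and> V \<subseteq> U \<and>
        (\<exists>\<beta>\<in>plots X m V. \<forall>s\<in>V. \<alpha> s = f (\<beta> s)))"

definition product_dspace :: "'a dspace \<Rightarrow> 'b dspace \<Rightarrow> ('a \<times> 'b) dspace" where
  "product_dspace X Y =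
     \<lparr>points = points X \<times> points Y,
      plots = (\<lambda>m U. {\<gamma> \<in> U \<rightarrow>\<^sub>E points X \<times> points Y.
         restrict (fst \<circ> \<gamma>) U \<in> plots X m U \<and> restrict (snd \<circ> \<gamma>) U \<in> plots Y m U})\<rparr>"

definition subset_dspace :: "'a dspace \<Rightarrow> 'a set \<Rightarrow> 'a dspace" where
  "subset_dspace X A =
     \<lparr>points = points X \<inter> A,
      plots = (\<lambda>m U. {\<alpha> \<in> plots X m U. \<alpha> ` U \<subseteq> A})\<rparr>"

definition fibred_product ::
    "'a dspace \<Rightarrow> 'b dspace \<Rightarrow> ('a \<Rightarrow> 'c) \<Rightarrow> ('b \<Rightarrow> 'c) \<Rightarrow> ('a \<times> 'b) dspace" where
  "fibred_product X Y f g = subset_dspace (product_dspace X Y) {(x, y). f x = g y}"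

text \<open>
  The quotient by a relation \<open>r\<close> uses the library's set of classes \<^term>\<open>points X // r\<close>, with
  projection \<open>x \<mapsto> r `` {x}\<close>.
\<close>

definition quotient_dspace :: "'a dspace \<Rightarrow> ('a \<times> 'a) set \<Rightarrow> 'a set dspace" where
  "quotient_dspace X r =
     \<lparr>points = points X // r,
      plots = (\<lambda>m U. {\<alpha> \<in> U \<rightarrow>\<^sub>E points X // r. Euclidean_domain m U \<and>
         (\<forall>t\<in>U. \<exists>V. Euclidean_domain m V \<and> t \<in> V \<and> V \<subseteq> U \<and>
            (\<exists>\<beta>\<in>plots X m V. \<forall>s\<in>V. \<alpha> s = r `` {\<beta> s}))})\<rparr>"


section \<open>Diffeological groupoids\<close>

text \<open>\<open>arr_comp G g h\<close> is \<open>g \<circ> h\<close>, meaningful when \<open>src G g = trg G h\<close>.\<close>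

record ('o, 'a) dgroupoid =
  Obj :: "'o dspace"
  Arr :: "'a dspace"
  src :: "'a \<Rightarrow> 'o"
  trg :: "'a \<Rightarrow> 'o"
  ident :: "'o \<Rightarrow> 'a"
  arr_inv :: "'a \<Rightarrow> 'a"
  arr_comp :: "'a \<Rightarrow> 'a \<Rightarrow> 'a"

locale diffeological_groupoid =
  Obj: diffeological_space "Obj G" + Arr: diffeological_space "Arr G"
  for G :: "('o, 'a) dgroupoid" +
  assumes smooth_src: "smooth_map (Arr G) (Obj G) (src G)"
    and smooth_trg: "smooth_map (Arr G) (Obj G) (trg G)"
    and smooth_ident: "smooth_map (Obj G) (Arr G) (ident G)"
    and smooth_inv: "smooth_map (Arr G) (Arr G) (arr_inv G)"
    and smooth_comp:
      "smooth_map (fibred_product (Arr G) (Arr G) (src G) (trg G)) (Arr G) (\<lambda>(g, h). arr_comp G g h)"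
    and src_ident: "x \<in> points (Obj G) \<Longrightarrow> src G (ident G x) = x"
    and trg_ident: "x \<in> points (Obj G) \<Longrightarrow> trg G (ident G x) = x"
    and src_comp:
      "\<lbrakk>g \<in> points (Arr G); h \<in> points (Arr G); src G g = trg G h\<rbrakk>
        \<Longrightarrow> src G (arr_comp G g h) = src G h"
    and trg_comp:
      "\<lbrakk>g \<in> points (Arr G); h \<in> points (Arr G); src G g = trg G h\<rbrakk>
        \<Longrightarrow> trg G (arr_comp G g h) = trg G g"
    and comp_assoc:
      "\<lbrakk>g \<in> points (Arr G); h \<in> points (Arr G); k \<in> points (Arr G); src G g = trg G h; src G h = trg G k\<rbrakk>
        \<Longrightarrow> arr_comp G (arr_comp G g h) k = arr_comp G g (arr_comp G h k)"
    and comp_ident: "g \<in> points (Arr G) \<Longrightarrow> arr_comp G g (ident G (src G g)) = g"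
    and ident_comp: "g \<in> points (Arr G) \<Longrightarrow> arr_comp G (ident G (trg G g)) g = g"
    and src_inv: "g \<in> points (Arr G) \<Longrightarrow> src G (arr_inv G g) = trg G g"
    and trg_inv: "g \<in> points (Arr G) \<Longrightarrow> trg G (arr_inv G g) = src G g"
    and comp_inv: "g \<in> points (Arr G) \<Longrightarrow> arr_comp G g (arr_inv G g) = ident G (trg G g)"
    and inv_comp: "g \<in> points (Arr G) \<Longrightarrow> arr_comp G (arr_inv G g) g = ident G (src G g)"

definition orbit :: "('o, 'a) dgroupoid \<Rightarrow> 'o \<Rightarrow> 'o set" where
  "orbit G x = {y \<in> points (Obj G). \<exists>g\<in>points (Arr G). src G g = x \<and> trg G g = y}"

definition orbit_rel :: "('o, 'a) dgroupoid \<Rightarrow> ('o \<times> 'o) set" where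
  "orbit_rel G = {(x, y). x \<in> points (Obj G) \<and> y \<in> orbit G x}"

definition orbit_space :: "('o, 'a) dgroupoid \<Rightarrow> 'o set dspace" where
  "orbit_space G = quotient_dspace (Obj G) (orbit_rel G)"


section \<open>Actions, bibundles and Morita equivalence\<close>

locale smooth_left_action =
  diffeological_groupoid G + diffeological_space X
  for G :: "('o, 'a) dgroupoid" and X :: "'x dspace" +
  fixes l :: "'x \<Rightarrow> 'o" and act :: "'a \<Rightarrow> 'x \<Rightarrow> 'x"
  assumes smooth_moment: "smooth_map X (Obj G) l"
    and smooth_act: "smooth_map (fibred_product (Arr G) X (src G) l) X (\<lambda>(g, x). act g x)"
    and moment_act:
      "\<lbrakk>g \<in> points (Arr G); x \<in> points X; src G g = l x\<rbrakk> \<Longrightarrow> l (act g x) = trg G g"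
    and ident_act: "x \<in> points X \<Longrightarrow> act (ident G (l x)) x = x"
    and act_act:
      "\<lbrakk>h \<in> points (Arr G); g \<in> points (Arr G); x \<in> points X; src G h = trg G g; src G g = l x\<rbrakk>
        \<Longrightarrow> act h (act g x) = act (arr_comp G h g) x"

locale smooth_right_action =
  diffeological_groupoid H + diffeological_space X
  for H :: "('o, 'a) dgroupoid" and X :: "'x dspace" +
  fixes r :: "'x \<Rightarrow> 'o" and act :: "'x \<Rightarrow> 'a \<Rightarrow> 'x"
  assumes smooth_moment: "smooth_map X (Obj H) r"
    and smooth_act: "smooth_map (fibred_product X (Arr H) r (trg H)) X (\<lambda>(x, h). act x h)"
    and moment_act:
      "\<lbrakk>x \<in> points X; h \<in> points (Arr H); r x = trg H h\<rbrakk> \<Longrightarrow> r (act x h) = src H h"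
    and act_ident: "x \<in> points X \<Longrightarrow> act x (ident H (r x)) = x"
    and act_act:
      "\<lbrakk>x \<in> points X; h \<in> points (Arr H); h' \<in> points (Arr H); r x = trg H h; src H h = trg H h'\<rbrakk>
        \<Longrightarrow> act (act x h) h' = act x (arr_comp H h h')"

locale bibundle =
  left: smooth_left_action G X l lact + right: smooth_right_action H X r ract
  for G :: "('g0, 'g) dgroupoid" and H :: "('h0, 'h) dgroupoid" and X :: "'x dspace"
    and l :: "'x \<Rightarrow> 'g0" and r :: "'x \<Rightarrow> 'h0"
    and lact :: "'g \<Rightarrow> 'x \<Rightarrow> 'x" and ract :: "'x \<Rightarrow> 'h \<Rightarrow> 'x" +
  assumes l_ract:
      "\<lbrakk>x \<in> points X; h \<in> points (Arr H); r x = trg H h\<rbrakk> \<Longrightarrow> l (ract x h) = l x"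
    and r_lact:
      "\<lbrakk>g \<in> points (Arr G); x \<in> points X; src G g = l x\<rbrakk> \<Longrightarrow> r (lact g x) = r x"
    and lact_ract:
      "\<lbrakk>g \<in> points (Arr G); x \<in> points X; h \<in> points (Arr H); src G g = l x; r x = trg H h\<rbrakk>
        \<Longrightarrow> ract (lact g x) h = lact g (ract x h)"

locale biprincipal_bibundle = bibundle +
  assumes subduction_l: "subduction X (Obj G) l"
    and subduction_r: "subduction X (Obj H) r"
    and left_principal:
      "diffeomorphism (fibred_product (Arr G) X (src G) l) (fibred_product X X r r)
         (\<lambda>(g, x). (lact g x, x))"
    and right_principal:
      "diffeomorphism (fibred_product X (Arr H) r (trg H)) (fibred_product X X l l)
         (\<lambda>(x, h). (x, ract x h))"

text \<open>
  HOL cannot quantify existentially over the type \<open>'x\<close> of points of the bibundle, so \<open>'x\<close> is a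
  parameter of the definition.  In a theorem with Morita equivalence as a hypothesis, the implicit
  universal quantification over \<open>'x\<close> amounts to allowing a bibundle over any type.
\<close>

definition Morita_equivalent ::
    "'x itself \<Rightarrow> ('g0, 'g) dgroupoid \<Rightarrow> ('h0, 'h) dgroupoid \<Rightarrow> bool" where
  "Morita_equivalent (_ :: 'x itself) G H \<longleftrightarrow>
     (\<exists>(X :: 'x dspace) l r lact ract. biprincipal_bibundle G H X l r lact ract)"


section \<open>The constructions are well defined\<close>

lemma C_k_on_const: "C_k_on k m U (\<lambda>_. c)"
proof (induction k arbitrary: c)
  case (Suc k)
  have "\<exists>f'. C_k_on k m U f' \<and>
      (\<forall>x\<in>U. ((\<lambda>s::real. c) has_real_derivative f' x) (at (x i)))" for i
    by (rule exI[of _ "\<lambda>_. 0"]) (use Suc in auto)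
  then show ?case by simp
qed simp

lemma C_k_on_coordinate: "C_k_on k m U (\<lambda>x. x j)"
proof (cases k)
  case (Suc n)
  have "\<exists>f'. C_k_on n m U f' \<and>
      (\<forall>x\<in>U. ((\<lambda>s. (x(i := s)) j) has_real_derivative f' x) (at (x i)))" for i
    by (rule exI[of _ "\<lambda>_. if i = j then 1 else 0"]) (auto intro: C_k_on_const)
  then show ?thesis
    using Suc by (auto intro: continuous_on_subset[OF continuous_on_product_coordinates])
qed (auto intro: continuous_on_subset[OF continuous_on_product_coordinates])

lemma C_k_on_subset: "C_k_on k m U f \<Longrightarrow> V \<subseteq> U \<Longrightarrow> C_k_on k m V f"
proof (induction k arbitrary: f)
  case (Suc k)
  have "\<exists>f'. C_k_on k m V f' \<and>
      (\<forall>x\<in>V. ((\<lambda>s. f (x(i := s))) has_real_derivative f' x) (at (x i)))" if "i < m" for i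
  proof -
    obtain f' where "C_k_on k m U f'"
      "\<forall>x\<in>U. ((\<lambda>s. f (x(i := s))) has_real_derivative f' x) (at (x i))"
      using Suc.prems \<open>i < m\<close> by auto
    then show ?thesis using Suc.IH Suc.prems(2) by blast
  qed
  then show ?case using Suc.prems by (auto intro: continuous_on_subset)
qed (auto intro: continuous_on_subset)

lemma smooth_domain_map_subset:
  "\<lbrakk>smooth_domain_map n V m U h; V' \<subseteq> V; h ` V' \<subseteq> U'\<rbrakk> \<Longrightarrow> smooth_domain_map n V' m U' h"
  unfolding smooth_domain_map_def smooth_real_on_def by (blast intro: C_k_on_subset)

lemma smooth_domain_map_inclusion: "V \<subseteq> U \<Longrightarrow> smooth_domain_map m V m U (\<lambda>x. x)"
  unfolding smooth_domain_map_def smooth_real_on_def by (auto intro: C_k_on_coordinate)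

lemma openin_smooth_domain_map_preimage:
  assumes h: "smooth_domain_map n V m U h" and V: "Euclidean_domain n V"
    and U: "Euclidean_domain m U" and W: "Euclidean_domain m W"
  shows "Euclidean_domain n {x \<in> V. h x \<in> W}"
proof -
  let ?T = "subtopology (Euclidean_space n) V"
  have V0: "topspace ?T = V"
    using openin_subset[OF V] by auto
  have hU: "h x \<in> topspace (Euclidean_space m)" if "x \<in> V" for x
    using h that openin_subset[OF U] by (auto simp: smooth_domain_map_def)
  have "continuous_map ?T euclideanreal (\<lambda>x. h x i)" if "i < m" for i
  proof -
    have "C_k_on 0 n V (\<lambda>x. h x i)"
      using h that unfolding smooth_domain_map_def smooth_real_on_def by blast
    then have "continuous_on V (\<lambda>x. h x i)" by simp
    moreover have "?T = top_of_set V"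
      using openin_subset[OF V]
      by (simp add: Euclidean_space_def euclidean_product_topology subtopology_subtopology
          inf.absorb2)
    ultimately show ?thesis by simp
  qed
  then have "continuous_map ?T (Euclidean_space m) (\<lambda>x i. if i < m then h x i else 0)"
    by (simp add: continuous_map_componentwise_Euclidean_space)
  then have "continuous_map ?T (Euclidean_space m) h"
    by (rule continuous_map_eq) (use hU V0 in \<open>auto simp: topspace_Euclidean_space fun_eq_iff\<close>)
  then have "openin ?T {x \<in> topspace ?T. h x \<in> W}"
    using W by (rule openin_continuous_map_preimage)
  then show ?thesis
    using V unfolding V0 by (simp add: openin_open_subtopology)
qed

context diffeological_space
begin

lemma plot_restrict:
  assumes "\<alpha> \<in> plots X m U" "Euclidean_domain m V" "V \<subseteq> U"
  shows "restrict \<alpha> V \<in> plots X m V"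
  using plot_compose[OF assms(1,2) smooth_domain_map_inclusion[OF assms(3)]] by (simp add: o_def)

end

lemma diffeological_space_product:
  assumes "diffeological_space X" "diffeological_space Y"
  shows "diffeological_space (product_dspace X Y)"
proof -
  interpret X: diffeological_space X by fact
  interpret Y: diffeological_space Y by fact
  show ?thesis
  proof
    fix \<alpha> m U assume "\<alpha> \<in> plots (product_dspace X Y) m U"
    then show "Euclidean_domain m U" "\<alpha> \<in> U \<rightarrow>\<^sub>E points (product_dspace X Y)"
      by (auto simp: product_dspace_def dest: X.plot_domain)
  next
    fix m U x assume "Euclidean_domain m U" "x \<in> points (product_dspace X Y)"
    then show "(\<lambda>_\<in>U. x) \<in> plots (product_dspace X Y) m U"
      using X.plot_const[of m U "fst x"] Y.plot_const[of m U "snd x"]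
      by (auto simp: product_dspace_def o_def restrict_def cong: if_cong)
  next
    fix \<alpha> m U n V h
    assume a: "\<alpha> \<in> plots (product_dspace X Y) m U" "Euclidean_domain n V"
      "smooth_domain_map n V m U h"
    then have hV: "h \<in> V \<rightarrow> U" by (simp add: smooth_domain_map_def)
    have *: "restrict (f \<circ> restrict (\<alpha> \<circ> h) V) V = restrict (restrict (f \<circ> \<alpha>) U \<circ> h) V"
      for f :: "'a \<times> 'b \<Rightarrow> 'c"
      using hV by (auto simp: restrict_def fun_eq_iff)
    show "restrict (\<alpha> \<circ> h) V \<in> plots (product_dspace X Y) n V"
      using a hV X.plot_compose[OF _ a(2,3)] Y.plot_compose[OF _ a(2,3)]
      by (auto simp: product_dspace_def * PiE_iff)
  next
    fix m U \<alpha> \<V>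
    assume a: "Euclidean_domain m U" "\<alpha> \<in> U \<rightarrow>\<^sub>E points (product_dspace X Y)" "\<Union>\<V> = U"
      "\<And>V. V \<in> \<V> \<Longrightarrow> Euclidean_domain m V \<and> restrict \<alpha> V \<in> plots (product_dspace X Y) m V"
    have *: "restrict (restrict (f \<circ> \<alpha>) U) V = restrict (f \<circ> restrict \<alpha> V) V" if "V \<in> \<V>"
      for V and f :: "'a \<times> 'b \<Rightarrow> 'c"
      using a(3) that by (auto simp: restrict_def fun_eq_iff)
    have mem: "\<alpha> x \<in> points X \<times> points Y" if "x \<in> U" for x
      using a(2) that by (auto simp: product_dspace_def PiE_iff)
    have "restrict (fst \<circ> \<alpha>) U \<in> plots X m U"
      by (rule X.plot_local[OF a(1) _ a(3)])
        (use a(4) mem in \<open>auto simp: product_dspace_def mem_Times_iff * simp del: restrict_restrict\<close>)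
    moreover have "restrict (snd \<circ> \<alpha>) U \<in> plots Y m U"
      by (rule Y.plot_local[OF a(1) _ a(3)])
        (use a(4) mem in \<open>auto simp: product_dspace_def mem_Times_iff * simp del: restrict_restrict\<close>)
    ultimately show "\<alpha> \<in> plots (product_dspace X Y) m U"
      using a(2) by (simp add: product_dspace_def)
  qed
qed

lemma diffeological_space_subset:
  assumes "diffeological_space X"
  shows "diffeological_space (subset_dspace X A)"
proof -
  interpret diffeological_space X by fact
  show ?thesis
  proof
    fix \<alpha> m U assume "\<alpha> \<in> plots (subset_dspace X A) m U"
    then show "Euclidean_domain m U" "\<alpha> \<in> U \<rightarrow>\<^sub>E points (subset_dspace X A)"
      using plot_fun[of \<alpha> m U] by (auto simp: subset_dspace_def PiE_iff dest: plot_domain)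
  next
    fix m U x assume "Euclidean_domain m U" "x \<in> points (subset_dspace X A)"
    then show "(\<lambda>_\<in>U. x) \<in> plots (subset_dspace X A) m U"
      using plot_const by (auto simp: subset_dspace_def)
  next
    fix \<alpha> m U n V h
    assume "\<alpha> \<in> plots (subset_dspace X A) m U" "Euclidean_domain n V" "smooth_domain_map n V m U h"
    then show "restrict (\<alpha> \<circ> h) V \<in> plots (subset_dspace X A) n V"
      using plot_compose by (fastforce simp: subset_dspace_def smooth_domain_map_def)
  next
    fix m U \<alpha> \<V>
    assume a: "Euclidean_domain m U" "\<alpha> \<in> U \<rightarrow>\<^sub>E points (subset_dspace X A)" "\<Union>\<V> = U"
      "\<And>V. V \<in> \<V> \<Longrightarrow> Euclidean_domain m V \<and> restrict \<alpha> V \<in> plots (subset_dspace X A) m V"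
    have "\<alpha> \<in> plots X m U"
      by (rule plot_local[OF a(1) _ a(3)]) (use a(2,4) in \<open>auto simp: subset_dspace_def PiE_iff\<close>)
    then show "\<alpha> \<in> plots (subset_dspace X A) m U"
      using a(2) by (auto simp: subset_dspace_def PiE_iff)
  qed
qed

lemma diffeological_space_fibred_product:
  "\<lbrakk>diffeological_space X; diffeological_space Y\<rbrakk> \<Longrightarrow> diffeological_space (fibred_product X Y f g)"
  by (simp add: fibred_product_def diffeological_space_product diffeological_space_subset)

lemma diffeological_space_quotient:
  assumes "diffeological_space X"
  shows "diffeological_space (quotient_dspace X r)"
proof -
  interpret diffeological_space X by fact
  show ?thesis
  proof
    fix \<alpha> m U assume "\<alpha> \<in> plots (quotient_dspace X r) m U"
    then show "Euclidean_domain m U" "\<alpha> \<in> U \<rightarrow>\<^sub>E points (quotient_dspace X r)"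
      by (auto simp: quotient_dspace_def)
  next
    fix m U q assume U: "Euclidean_domain m U" and q: "q \<in> points (quotient_dspace X r)"
    then obtain x where x: "x \<in> points X" "q = r `` {x}"
      by (auto simp: quotient_dspace_def elim: quotientE)
    have "\<exists>\<beta>\<in>plots X m U. \<forall>s\<in>U. q = r `` {\<beta> s}"
      by (rule bexI[OF _ plot_const[OF U x(1)]]) (simp add: x)
    then show "(\<lambda>_\<in>U. q) \<in> plots (quotient_dspace X r) m U"
      using U q by (auto simp: quotient_dspace_def)
  next
    fix \<alpha> m U n V h
    assume a: "\<alpha> \<in> plots (quotient_dspace X r) m U" "Euclidean_domain n V"
      "smooth_domain_map n V m U h"
    then have hV: "h \<in> V \<rightarrow> U" and U: "Euclidean_domain m U"
      by (simp_all add: smooth_domain_map_def quotient_dspace_def)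
    have "\<exists>W. Euclidean_domain n W \<and> t \<in> W \<and> W \<subseteq> V \<and>
        (\<exists>\<beta>\<in>plots X n W. \<forall>s\<in>W. \<alpha> (h s) = r `` {\<beta> s})" if t: "t \<in> V" for t
    proof -
      have "h t \<in> U" using t hV by auto
      then obtain W \<beta> where W: "Euclidean_domain m W" "h t \<in> W" "W \<subseteq> U"
        and \<beta>: "\<beta> \<in> plots X m W" "\<forall>s\<in>W. \<alpha> s = r `` {\<beta> s}"
        using a(1) by (auto simp: quotient_dspace_def)
      define W' where "W' = {x \<in> V. h x \<in> W}"
      have W': "Euclidean_domain n W'"
        unfolding W'_def by (rule openin_smooth_domain_map_preimage[OF a(3,2) U W(1)])
      have "smooth_domain_map n W' m W h"
        by (rule smooth_domain_map_subset[OF a(3)]) (auto simp: W'_def)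
      from plot_compose[OF \<beta>(1) W' this]
      have "restrict (\<beta> \<circ> h) W' \<in> plots X n W'" .
      moreover have "\<forall>s\<in>W'. \<alpha> (h s) = r `` {restrict (\<beta> \<circ> h) W' s}"
        using \<beta>(2) by (auto simp: W'_def)
      ultimately show ?thesis
        using W' t W(2) by (intro exI[of _ W'] conjI bexI) (auto simp: W'_def)
    qed
    note lift = this
    have "\<exists>W. Euclidean_domain n W \<and> t \<in> W \<and> W \<subseteq> V \<and>
        (\<exists>\<beta>\<in>plots X n W. \<forall>s\<in>W. restrict (\<alpha> \<circ> h) V s = r `` {\<beta> s})" if t: "t \<in> V" for t
    proof -
      obtain W \<beta> where W: "Euclidean_domain n W" "t \<in> W" "W \<subseteq> V" and \<beta>: "\<beta> \<in> plots X n W"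
        and eq: "\<forall>s\<in>W. \<alpha> (h s) = r `` {\<beta> s}"
        using lift[OF t] by blast
      have "\<forall>s\<in>W. restrict (\<alpha> \<circ> h) V s = r `` {\<beta> s}"
        using eq W(3) by auto
      with W \<beta> show ?thesis by blast
    qed
    moreover have "restrict (\<alpha> \<circ> h) V \<in> V \<rightarrow>\<^sub>E points X // r"
      using a(1) hV by (auto simp: quotient_dspace_def PiE_iff)
    ultimately show "restrict (\<alpha> \<circ> h) V \<in> plots (quotient_dspace X r) n V"
      using a(2) by (simp add: quotient_dspace_def)
  next
    fix m U \<alpha> \<V>
    assume a: "Euclidean_domain m U" "\<alpha> \<in> U \<rightarrow>\<^sub>E points (quotient_dspace X r)" "\<Union>\<V> = U"
      "\<And>V. V \<in> \<V> \<Longrightarrow> Euclidean_domain m V \<and> restrict \<alpha> V \<in> plots (quotient_dspace X r) m V"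
    have "\<exists>W. Euclidean_domain m W \<and> t \<in> W \<and> W \<subseteq> U \<and>
        (\<exists>\<beta>\<in>plots X m W. \<forall>s\<in>W. \<alpha> s = r `` {\<beta> s})" if t: "t \<in> U" for t
    proof -
      obtain V where V: "V \<in> \<V>" "t \<in> V" using a(3) t by auto
      then obtain W \<beta> where W: "Euclidean_domain m W" "t \<in> W" "W \<subseteq> V" and \<beta>: "\<beta> \<in> plots X m W"
        and eq: "\<forall>s\<in>W. restrict \<alpha> V s = r `` {\<beta> s}"
        using a(4)[OF V(1)] by (simp add: quotient_dspace_def) blast
      have "\<alpha> s = r `` {\<beta> s}" if "s \<in> W" for s
        using bspec[OF eq that] that W(3) by (simp add: subset_iff)
      moreover have "W \<subseteq> U" using W(3) V(1) a(3) by auto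
      ultimately show ?thesis using W \<beta> by blast
    qed
    then show "\<alpha> \<in> plots (quotient_dspace X r) m U"
      using a(1,2) by (simp add: quotient_dspace_def)
  qed
qed

context diffeological_groupoid
begin

lemma equiv_orbit_rel: "equiv (points (Obj G)) (orbit_rel G)"
proof (rule equivI)
  show "orbit_rel G \<subseteq> points (Obj G) \<times> points (Obj G)"
    by (auto simp: orbit_rel_def orbit_def)
  show "refl_on (points (Obj G)) (orbit_rel G)"
    using smooth_ident
    by (auto simp: refl_on_def orbit_rel_def orbit_def smooth_map_def src_ident trg_ident
        intro!: bexI[of _ "ident G _"])
  show "sym (orbit_rel G)"
    using smooth_inv
    by (force simp: sym_def orbit_rel_def orbit_def smooth_map_def src_inv trg_inv)
  show "trans (orbit_rel G)"
  proof (rule transI)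
    fix x y z assume "(x, y) \<in> orbit_rel G" "(y, z) \<in> orbit_rel G"
    then obtain h g where hg: "h \<in> points (Arr G)" "g \<in> points (Arr G)"
        "src G h = x" "trg G h = y" "src G g = y" "trg G g = z"
      and xz: "x \<in> points (Obj G)" "z \<in> points (Obj G)"
      by (auto simp: orbit_rel_def orbit_def)
    have "(\<lambda>(g, h). arr_comp G g h)
        \<in> points (fibred_product (Arr G) (Arr G) (src G) (trg G)) \<rightarrow> points (Arr G)"
      using smooth_comp by (simp add: smooth_map_def)
    then have "arr_comp G g h \<in> points (Arr G)"
      using hg
      by (auto simp: fibred_product_def subset_dspace_def product_dspace_def
          dest!: funcset_mem[where x = "(g, h)"])
    then show "(x, z) \<in> orbit_rel G"
      using hg xz src_comp[of g h] trg_comp[of g h] by (auto simp: orbit_rel_def orbit_def)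
  qed
qed

lemma points_orbit_space: "points (orbit_space G) = orbit G ` points (Obj G)"
  by (auto simp: orbit_space_def quotient_dspace_def quotient_def orbit_rel_def)

lemma diffeological_space_orbit_space: "diffeological_space (orbit_space G)"
  unfolding orbit_space_def by (rule diffeological_space_quotient) (rule Obj.diffeological_space_axioms)

end

end

theory Submission
  imports Defs
begin

text \<open>
  Let \<open>X\<close> be a biprincipal \<open>(G, H)\<close>-bibundle with moment maps \<open>l\<close> and \<open>r\<close>.  Two points of \<open>X\<close> lie
  over the same \<open>G\<close>-orbit if and only if they lie over the same \<open>H\<close>-orbit.  Indeed, an arrow of \<open>G\<close>
  from \<open>l x\<close> to \<open>l x'\<close> moves \<open>x\<close> to a point over \<open>l x'\<close> without changing \<open>r x\<close>, and then
  principality of the \<open>H\<close>-action provides an arrow of \<open>H\<close> that moves this point to \<open>x'\<close>; the converse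
  exchanges the two actions (\<open>related_moments_iff\<close>).  So \<open>l\<close> and \<open>r\<close> induce the same equivalence
  relation on \<open>X\<close>, and since both are surjective, \<open>l x \<mapsto> r x\<close> descends to a bijection of orbit
  spaces.

  The bijection and its inverse are smooth because plots can be lifted: a plot of one orbit space
  lifts locally to a plot of the object space, then along the moment map, a subduction, to a plot of
  \<open>X\<close>, and can be pushed down the other side.  This second half concerns only a span of
  subductions \<open>A \<leftarrow> X \<rightarrow> B\<close> with compatible equivalence relations on \<open>A\<close> and \<open>B\<close>
  (\<open>diffeomorphism_class_transfer\<close>).
\<close>

text \<open>
  For a class of points of \<open>A\<close> this is the saturation under \<open>S\<close> of its image under the
  correspondence \<open>A \<leftarrow> X \<rightarrow> B\<close>; defining it on sets avoids choosing a point of \<open>X\<close> above the class.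
\<close>

definition class_transfer ::
    "'x dspace \<Rightarrow> ('x \<Rightarrow> 'a) \<Rightarrow> ('x \<Rightarrow> 'b) \<Rightarrow> ('b \<times> 'b) set \<Rightarrow> 'a set \<Rightarrow> 'b set" where
  "class_transfer X p q S C = S `` (q ` {x \<in> points X. p x \<in> C})"

lemma class_transfer_class:
  assumes R: "equiv A R" and S: "equiv B S" and p: "p \<in> points X \<rightarrow> A"
    and compat: "\<And>x x'. \<lbrakk>x \<in> points X; x' \<in> points X; (p x, p x') \<in> R\<rbrakk> \<Longrightarrow> (q x, q x') \<in> S"
    and x: "x \<in> points X"
  shows "class_transfer X p q S (R `` {p x}) = S `` {q x}"
proof
  show "class_transfer X p q S (R `` {p x}) \<subseteq> S `` {q x}"
    using compat[OF x] S unfolding class_transfer_def equiv_def trans_def by blast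
  have "(p x, p x) \<in> R"
    using R p x by (auto simp: equiv_def refl_on_def)
  then show "S `` {q x} \<subseteq> class_transfer X p q S (R `` {p x})"
    using x unfolding class_transfer_def by blast
qed

text \<open>
  Local lifts compose: a plot of the quotient of \<open>A\<close> lifts to \<open>A\<close> near every point, and on a smaller
  neighbourhood to \<open>X\<close>, because \<open>p\<close> is a subduction.
\<close>

lemma quotient_plot_lift:
  assumes p: "subduction X A p" and \<alpha>: "\<alpha> \<in> plots (quotient_dspace A R) m U" and t: "t \<in> U"
  obtains W \<gamma> where "Euclidean_domain m W" "t \<in> W" "W \<subseteq> U" "\<gamma> \<in> plots X m W"
    "\<And>s. s \<in> W \<Longrightarrow> \<alpha> s = R `` {p (\<gamma> s)}"
proof -
  obtain V \<beta> where V: "t \<in> V" "V \<subseteq> U" and \<beta>: "\<beta> \<in> plots A m V" "\<forall>s\<in>V. \<alpha> s = R `` {\<beta> s}"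
    using \<alpha> t by (auto simp: quotient_dspace_def)
  have "\<exists>W. Euclidean_domain m W \<and> t \<in> W \<and> W \<subseteq> V \<and>
      (\<exists>\<gamma>\<in>plots X m W. \<forall>s\<in>W. \<beta> s = p (\<gamma> s))"
    using p \<beta>(1) V(1) by (simp add: subduction_def)
  then obtain W \<gamma> where "Euclidean_domain m W" "t \<in> W" "W \<subseteq> V" "\<gamma> \<in> plots X m W"
    "\<forall>s\<in>W. \<beta> s = p (\<gamma> s)"
    by blast
  with V \<beta>(2) show ?thesis
    using that[of W \<gamma>] by (metis subset_iff)
qed

lemma quotient_image: "(p ` T) // R = (\<lambda>x. R `` {p x}) ` T"
  by (auto simp: quotient_def)

lemma smooth_map_class_transfer:
  assumes X: "diffeological_space X" and R: "equiv (points A) R" and S: "equiv (points B) S"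
    and p: "subduction X A p" and q: "smooth_map X B q"
    and compat: "\<And>x x'. \<lbrakk>x \<in> points X; x' \<in> points X; (p x, p x') \<in> R\<rbrakk> \<Longrightarrow> (q x, q x') \<in> S"
  shows "smooth_map (quotient_dspace A R) (quotient_dspace B S) (class_transfer X p q S)"
proof -
  interpret X: diffeological_space X by fact
  let ?f = "class_transfer X p q S"
  have p_fun: "p \<in> points X \<rightarrow> points A" and p_surj: "p ` points X = points A"
    using p by (auto simp: subduction_def smooth_map_def)
  have q_fun: "q x \<in> points B" if "x \<in> points X" for x
    using q that by (auto simp: smooth_map_def)
  have f_class: "?f (R `` {p x}) = S `` {q x}" if "x \<in> points X" for x
    by (rule class_transfer_class[OF R S p_fun compat that])
  have f_fun: "?f C \<in> points B // S" if "C \<in> points A // R" for C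
  proof -
    obtain x where "x \<in> points X" "C = R `` {p x}"
      using \<open>C \<in> points A // R\<close> unfolding p_surj[symmetric] quotient_image by blast
    then show ?thesis
      using f_class q_fun by (auto intro: quotientI)
  qed
  have "restrict (?f \<circ> \<alpha>) U \<in> plots (quotient_dspace B S) m U"
    if \<alpha>: "\<alpha> \<in> plots (quotient_dspace A R) m U" for m U \<alpha>
  proof -
    have "\<exists>W. Euclidean_domain m W \<and> t \<in> W \<and> W \<subseteq> U \<and>
        (\<exists>\<delta>\<in>plots B m W. \<forall>s\<in>W. restrict (?f \<circ> \<alpha>) U s = S `` {\<delta> s})" if t: "t \<in> U" for t
    proof -
      obtain W \<gamma> where W: "Euclidean_domain m W" "t \<in> W" "W \<subseteq> U" and \<gamma>: "\<gamma> \<in> plots X m W"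
        and eq: "\<And>s. s \<in> W \<Longrightarrow> \<alpha> s = R `` {p (\<gamma> s)}"
        using quotient_plot_lift[OF p \<alpha> t] by blast
      have "restrict (q \<circ> \<gamma>) W \<in> plots B m W"
        using q \<gamma> by (simp add: smooth_map_def)
      moreover have "restrict (?f \<circ> \<alpha>) U s = S `` {restrict (q \<circ> \<gamma>) W s}" if "s \<in> W" for s
      proof -
        have "\<gamma> s \<in> points X"
          using X.plot_fun[OF \<gamma>] that by (auto simp: PiE_iff)
        then show ?thesis
          using W(3) that by (simp add: eq f_class subset_iff)
      qed
      ultimately show ?thesis
        using W by blast
    qed
    then show ?thesis
      using \<alpha> f_fun by (auto simp: quotient_dspace_def PiE_iff)
  qed
  moreover have "?f \<in> points (quotient_dspace A R) \<rightarrow> points (quotient_dspace B S)"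
    using f_fun by (simp add: quotient_dspace_def)
  ultimately show ?thesis
    unfolding smooth_map_def by blast
qed

lemma diffeomorphismI:
  assumes X: "diffeological_space X" and Y: "diffeological_space Y"
    and f: "smooth_map X Y f" and g: "smooth_map Y X g"
    and gf: "\<And>x. x \<in> points X \<Longrightarrow> g (f x) = x" and fg: "\<And>y. y \<in> points Y \<Longrightarrow> f (g y) = y"
  shows "diffeomorphism X Y f"
proof -
  interpret Y: diffeological_space Y by fact
  have bij: "bij_betw f (points X) (points Y)"
    using f g gf fg by (intro bij_betw_byWitness[of _ g]) (auto simp: smooth_map_def)
  have inv: "inv_into (points X) f y = g y" if "y \<in> points Y" for y
  proof -
    have "g y \<in> points X"
      using g that by (auto simp: smooth_map_def)
    then show ?thesis
      using bij fg[OF that] inv_into_f_f by (metis bij_betw_def)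
  qed
  have "restrict (inv_into (points X) f \<circ> \<alpha>) U = restrict (g \<circ> \<alpha>) U" if "\<alpha> \<in> plots Y m U" for m U \<alpha>
    using Y.plot_fun[OF that] inv by (auto simp: restrict_def PiE_iff fun_eq_iff)
  then have "smooth_map Y X (inv_into (points X) f)"
    using g inv by (auto simp: smooth_map_def)
  with bij f show ?thesis
    by (simp add: diffeomorphism_def)
qed

text \<open>
  The hypotheses are symmetric in the two legs, so the inverse is the transfer in the opposite
  direction: the two transfers exchange \<open>R `` {p x}\<close> and \<open>S `` {q x}\<close>, and every class on
  either side has this form because \<open>p\<close> and \<open>q\<close> are onto.
\<close>

lemma diffeomorphism_class_transfer:
  assumes X: "diffeological_space X" and A: "diffeological_space A" and B: "diffeological_space B"
    and R: "equiv (points A) R" and S: "equiv (points B) S"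
    and p: "subduction X A p" and q: "subduction X B q"
    and compat: "\<And>x x'. \<lbrakk>x \<in> points X; x' \<in> points X\<rbrakk> \<Longrightarrow> (p x, p x') \<in> R \<longleftrightarrow> (q x, q x') \<in> S"
  shows "diffeomorphism (quotient_dspace A R) (quotient_dspace B S) (class_transfer X p q S)"
proof -
  have p_smooth: "smooth_map X A p" and q_smooth: "smooth_map X B q"
    and p_fun: "p \<in> points X \<rightarrow> points A" and q_fun: "q \<in> points X \<rightarrow> points B"
    and p_surj: "p ` points X = points A" and q_surj: "q ` points X = points B"
    using p q by (auto simp: subduction_def smooth_map_def)
  have fwd: "class_transfer X p q S (R `` {p x}) = S `` {q x}" if "x \<in> points X" for x
    by (rule class_transfer_class[OF R S p_fun _ that]) (simp add: compat)
  have bwd: "class_transfer X q p R (S `` {q x}) = R `` {p x}" if "x \<in> points X" for x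
    by (rule class_transfer_class[OF S R q_fun _ that]) (simp add: compat)
  show ?thesis
  proof (rule diffeomorphismI)
    show "diffeological_space (quotient_dspace A R)" "diffeological_space (quotient_dspace B S)"
      using A B by (simp_all add: diffeological_space_quotient)
    show "smooth_map (quotient_dspace A R) (quotient_dspace B S) (class_transfer X p q S)"
      by (rule smooth_map_class_transfer[OF X R S p q_smooth]) (simp add: compat)
    show "smooth_map (quotient_dspace B S) (quotient_dspace A R) (class_transfer X q p R)"
      by (rule smooth_map_class_transfer[OF X S R q p_smooth]) (simp add: compat)
  next
    fix C assume "C \<in> points (quotient_dspace A R)"
    then obtain x where "x \<in> points X" "C = R `` {p x}"
      by (auto simp: quotient_dspace_def quotient_image simp flip: p_surj)
    then show "class_transfer X q p R (class_transfer X p q S C) = C"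
      by (simp add: fwd bwd)
  next
    fix D assume "D \<in> points (quotient_dspace B S)"
    then obtain x where "x \<in> points X" "D = S `` {q x}"
      by (auto simp: quotient_dspace_def quotient_image simp flip: q_surj)
    then show "class_transfer X p q S (class_transfer X q p R D) = D"
      by (simp add: fwd bwd)
  qed
qed

lemma points_fibred_product:
  "points (fibred_product X Y f g) = {(x, y). x \<in> points X \<and> y \<in> points Y \<and> f x = g y}"
  by (auto simp: fibred_product_def subset_dspace_def product_dspace_def)

lemma (in diffeological_groupoid) orbit_rel_iff:
  "(x, y) \<in> orbit_rel G \<longleftrightarrow> (\<exists>g\<in>points (Arr G). src G g = x \<and> trg G g = y)"
  using smooth_src smooth_trg by (auto simp: orbit_rel_def orbit_def smooth_map_def)

context biprincipal_bibundle
begin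

lemma lact_closed:
  assumes "g \<in> points (Arr G)" "x \<in> points X" "src G g = l x"
  shows "lact g x \<in> points X"
  using left.smooth_act assms
  by (auto simp: smooth_map_def points_fibred_product dest!: funcset_mem[where x = "(g, x)"])

lemma ract_closed:
  assumes "x \<in> points X" "h \<in> points (Arr H)" "r x = trg H h"
  shows "ract x h \<in> points X"
  using right.smooth_act assms
  by (auto simp: smooth_map_def points_fibred_product dest!: funcset_mem[where x = "(x, h)"])

text \<open>
  Surjectivity of the action map onto the fibred square is transitivity on fibres: \<open>G\<close> acts
  transitively on the fibres of the right moment map, and \<open>H\<close> on those of the left one.
\<close>

lemma lact_transitive:
  assumes "x \<in> points X" "y \<in> points X" "r y = r x"
  obtains g where "g \<in> points (Arr G)" "src G g = l x" "lact g x = y"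
proof -
  have "(y, x) \<in> (\<lambda>(g, x). (lact g x, x)) ` points (fibred_product (Arr G) X (src G) l)"
    using left_principal assms by (auto simp: diffeomorphism_def bij_betw_def points_fibred_product)
  then show ?thesis
    using that by (auto simp: points_fibred_product)
qed

lemma ract_transitive:
  assumes "x \<in> points X" "y \<in> points X" "l x = l y"
  obtains h where "h \<in> points (Arr H)" "r x = trg H h" "ract x h = y"
proof -
  have "(x, y) \<in> (\<lambda>(x, h). (x, ract x h)) ` points (fibred_product X (Arr H) r (trg H))"
    using right_principal assms by (auto simp: diffeomorphism_def bij_betw_def points_fibred_product)
  then show ?thesis
    using that by (auto simp: points_fibred_product)
qed

lemma related_moments_iff:
  assumes x: "x \<in> points X" and x': "x' \<in> points X"
  shows "(l x, l x') \<in> orbit_rel G \<longleftrightarrow> (r x, r x') \<in> orbit_rel H"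
proof
  assume "(l x, l x') \<in> orbit_rel G"
  then obtain g where g: "g \<in> points (Arr G)" "src G g = l x" "trg G g = l x'"
    by (auto simp: left.orbit_rel_iff)
  have y: "lact g x \<in> points X" "l (lact g x) = l x'" "r (lact g x) = r x"
    using g x lact_closed left.moment_act r_lact by simp_all
  then obtain h where h: "h \<in> points (Arr H)" "r x = trg H h" "ract (lact g x) h = x'"
    using ract_transitive[OF y(1) x' y(2)] by metis
  then have "r x' = src H h"
    using right.moment_act[OF y(1) h(1)] y(3) by simp
  \<comment> \<open>A right action moves the moment from target to source, so \<open>h\<close> points backwards.\<close>
  then have "(r x', r x) \<in> orbit_rel H"
    using h by (auto simp: right.orbit_rel_iff)
  then show "(r x, r x') \<in> orbit_rel H"
    using right.equiv_orbit_rel by (auto simp: equiv_def elim: symE)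
next
  assume "(r x, r x') \<in> orbit_rel H"
  then obtain h where h: "h \<in> points (Arr H)" "src H h = r x" "trg H h = r x'"
    by (auto simp: right.orbit_rel_iff)
  have y: "ract x' h \<in> points X" "r (ract x' h) = r x" "l (ract x' h) = l x'"
    using h x' ract_closed right.moment_act l_ract by simp_all
  then obtain g where g: "g \<in> points (Arr G)" "src G g = l x" "lact g x = ract x' h"
    using lact_transitive[OF x y(1) y(2)] by metis
  then have "trg G g = l x'"
    using left.moment_act[OF g(1) x g(2)] y(3) by simp
  then show "(l x, l x') \<in> orbit_rel G"
    using g by (auto simp: left.orbit_rel_iff)
qed

end

theorem theorem6p1:
  fixes G :: "('g0, 'g) dgroupoid" and H :: "('h0, 'h) dgroupoid"
  assumes "diffeological_groupoid G" and "diffeological_groupoid H"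
    and "Morita_equivalent TYPE('x) G H"
  shows "\<exists>f. diffeomorphism (orbit_space G) (orbit_space H) f"
proof -
  interpret G: diffeological_groupoid G by fact
  interpret H: diffeological_groupoid H by fact
  obtain X :: "'x dspace" and l r lact ract where "biprincipal_bibundle G H X l r lact ract"
    using assms(3) by (auto simp: Morita_equivalent_def)
  then interpret biprincipal_bibundle G H X l r lact ract .
  have "diffeomorphism (orbit_space G) (orbit_space H) (class_transfer X l r (orbit_rel H))"
    unfolding orbit_space_def
    by (rule diffeomorphism_class_transfer[OF left.diffeological_space_axioms
          G.Obj.diffeological_space_axioms H.Obj.diffeological_space_axioms
          G.equiv_orbit_rel H.equiv_orbit_rel subduction_l subduction_r related_moments_iff])
  then show ?thesis
    by blast
qed

end
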